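(* Let $1\le s<\frac32$. For every $\delta>0$ there exists an initial datum $u_0\in H^s(\mathbb{R})$ with $\|u_0\|_{H^s}\le \delta$, a time $T_0$ with $0<T_0<\delta$, and a solution $u\in \mathcal{C}([0,T_0];H^s(\mathbb{R}))$ of the Cauchy problem for the Burgers equation $$\partial_t u+u\,u_x=0,\qquad u(0,x)=u_0(x),\quad x\in\mathbb{R},$$ such that $$\|u(T_0)\|_{H^s}\ge \frac1\delta .$$
   Context: Functions are real-valued. With $\widehat f(\xi)=\int_{\mathbb{R}}e^{-ix\xi}f(x)\,\mathrm{d}x$, the Sobolev norm is $\|f\|_{H^s}^2=\int_{\mathbb{R}}(1+\xi^2)^s|\widehat f(\xi)|^2\,\mathrm{d}\xi$. $\mathcal{C}(I;X)$ denotes the continuous functions on the interval $I$ with values in the Banach space $X$. A solution $u\in\mathcal{C}([0,T_0];H^s)$ (with $s\ge 1$) satisfies the equation in the sense of distributions on $(0,T_0)\times\mathbb{R}$ (with $u u_x=\frac12\partial_x(u^2)$, a well-defined element of $L^2(\mathbb{R})$ at each time), and $u(0)=u_0$. *)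

theory Defs
  imports "HOL-Analysis.Analysis"
begin

text \<open>
  Elements of \<open>L\<^sup>2\<close> and \<open>H\<^sup>s\<close> are represented by Borel functions; functions agreeing almost
  everywhere represent the same element.
\<close>

definition square_integrable :: "(real \<Rightarrow> 'a::{banach, second_countable_topology}) \<Rightarrow> bool" where
  "square_integrable f \<longleftrightarrow>
     f \<in> borel_measurable lborel \<and> integrable lborel (\<lambda>x. (norm (f x))\<^sup>2)"

text \<open>
  A function in \<open>L\<^sup>2\<close> need not be integrable, so its Fourier transform is the \<open>L\<^sup>2\<close> limit of the
  Fourier integrals over \<open>[-R, R]\<close> as \<open>R\<close> tends to infinity. The nonnegative integral is used for
  the \<open>L\<^sup>2\<close> distance because the Bochner integral of a non-integrable function is \<open>0\<close>.
\<close>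

definition has_fourier_transform :: "(real \<Rightarrow> real) \<Rightarrow> (real \<Rightarrow> complex) \<Rightarrow> bool" where
  "has_fourier_transform f g \<longleftrightarrow>
     square_integrable f \<and> square_integrable g \<and>
     ((\<lambda>R. \<integral>\<^sup>+ \<xi>. ennreal ((norm (g \<xi> -
          (LBINT x:{-R..R}. exp (- (\<i> * complex_of_real (x * \<xi>))) * complex_of_real (f x))))\<^sup>2)
        \<partial>lborel) \<longlongrightarrow> 0) at_top"

definition fourier_transform :: "(real \<Rightarrow> real) \<Rightarrow> real \<Rightarrow> complex" where
  "fourier_transform f = (SOME g. has_fourier_transform f g)"

text \<open>The following definition of \<open>H\<^sup>s\<close> is meant for \<open>s \<ge> 0\<close>, where \<open>H\<^sup>s\<close> is contained in \<open>L\<^sup>2\<close>.\<close>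

definition sobolev_space :: "real \<Rightarrow> (real \<Rightarrow> real) set" where
  "sobolev_space s = {f. \<exists>g. has_fourier_transform f g \<and>
     integrable lborel (\<lambda>\<xi>. (1 + \<xi>\<^sup>2) powr s * (norm (g \<xi>))\<^sup>2)}"

definition sobolev_norm :: "real \<Rightarrow> (real \<Rightarrow> real) \<Rightarrow> real" where
  "sobolev_norm s f = sqrt (LBINT \<xi>. (1 + \<xi>\<^sup>2) powr s * (norm (fourier_transform f \<xi>))\<^sup>2)"

definition continuous_into_sobolev :: "real \<Rightarrow> real set \<Rightarrow> (real \<Rightarrow> real \<Rightarrow> real) \<Rightarrow> bool" where
  "continuous_into_sobolev s I u \<longleftrightarrow>
     (\<forall>t\<in>I. u t \<in> sobolev_space s) \<and>
     (\<forall>t\<in>I. ((\<lambda>\<tau>. sobolev_norm s (\<lambda>x. u \<tau> x - u t x)) \<longlongrightarrow> 0) (at t within I))"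

definition partial_t :: "(real \<times> real \<Rightarrow> real) \<Rightarrow> real \<times> real \<Rightarrow> real" where
  "partial_t \<phi> = (\<lambda>(t, x). deriv (\<lambda>\<tau>. \<phi> (\<tau>, x)) t)"

definition partial_x :: "(real \<times> real \<Rightarrow> real) \<Rightarrow> real \<times> real \<Rightarrow> real" where
  "partial_x \<phi> = (\<lambda>(t, x). deriv (\<lambda>y. \<phi> (t, y)) x)"

fun k_times_cont_diff :: "nat \<Rightarrow> (real \<times> real \<Rightarrow> real) \<Rightarrow> bool" where
  "k_times_cont_diff 0 \<phi> \<longleftrightarrow> continuous_on UNIV \<phi>"
| "k_times_cont_diff (Suc k) \<phi> \<longleftrightarrow>
     continuous_on UNIV \<phi> \<and>
     (\<forall>t x. (\<lambda>\<tau>. \<phi> (\<tau>, x)) differentiable (at t) \<and> (\<lambda>y. \<phi> (t, y)) differentiable (at x)) \<and>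
     k_times_cont_diff k (partial_t \<phi>) \<and> k_times_cont_diff k (partial_x \<phi>)"

text \<open>
  Test functions on an open set \<open>\<Omega>\<close>, extended by zero to the whole plane.
\<close>

definition test_functions :: "(real \<times> real) set \<Rightarrow> (real \<times> real \<Rightarrow> real) set" where
  "test_functions \<Omega> = {\<phi>. (\<forall>k. k_times_cont_diff k \<phi>) \<and>
     compact (closure {p. \<phi> p \<noteq> 0}) \<and> closure {p. \<phi> p \<noteq> 0} \<subseteq> \<Omega>}"

text \<open>
  The equation \<open>\<partial>\<^sub>t u + \<partial>\<^sub>x (u\<^sup>2 / 2) = 0\<close> in the sense of distributions on \<open>(0, T) \<times> \<real>\<close>. The
  integral is iterated, so that it does not depend on the representatives chosen for the
  elements \<open>u t\<close>, which need not be jointly measurable in \<open>(t, x)\<close>; for \<open>u\<close> continuous in time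
  with values in \<open>L\<^sup>2\<close> the inner integral exists and is continuous in \<open>t\<close>.
\<close>

definition burgers_distributional :: "real \<Rightarrow> (real \<Rightarrow> real \<Rightarrow> real) \<Rightarrow> bool" where
  "burgers_distributional T u \<longleftrightarrow>
     (\<forall>\<phi> \<in> test_functions ({0<..<T} \<times> UNIV).
        (LBINT t:{0<..<T}. (LBINT x. u t x * partial_t \<phi> (t, x)
            + (u t x)\<^sup>2 / 2 * partial_x \<phi> (t, x))) = 0)"

definition burgers_solution ::
    "real \<Rightarrow> real \<Rightarrow> (real \<Rightarrow> real) \<Rightarrow> (real \<Rightarrow> real \<Rightarrow> real) \<Rightarrow> bool" where
  "burgers_solution s T u0 u \<longleftrightarrow>
     continuous_into_sobolev s {0..T} u \<and>
     burgers_distributional T u \<and>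
     (AE x in lborel. u 0 x = u0 x)"

end

theory Submission imports Defs begin

text \<open>
  A tent of height \<open>h\<close> supported on \<open>[-b, b]\<close> with its peak at \<open>0\<close> evolves under the Burgers flow into
  the tent with the same support and its peak at \<open>h t\<close>, as long as \<open>h t < b\<close>. The Fourier transform of
  a tent is explicit and \<open>O((1 + \<xi>\<^sup>2)\<^sup>-\<^sup>1)\<close>, so tents lie in \<open>H\<^sup>s\<close> for \<open>s < 3/2\<close>, and dominated convergence
  applies to their norms. Fix the slope \<open>h / b = 2 / \<delta>\<close>: the \<open>H\<^sup>s\<close> norm at time \<open>0\<close> tends to \<open>0\<close> with \<open>b\<close>,
  while the breaking time is \<open>b / h = \<delta> / 2\<close>. Close to it the squared \<open>H\<^sup>1\<close> norm is at least a constant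
  times \<open>h\<^sup>2 / (b - h t)\<close>, because of the frequencies of order \<open>1 / (b - h t)\<close>.
\<close>

section \<open>Fourier integrals of continuous functions with compact support\<close>

text \<open>A concrete representative of the transform for integrable functions;
  \<open>fourier_transform\<close> is chosen by \<open>SOME\<close> and is determined only almost
  everywhere.\<close>

definition fourier_integral :: "(real \<Rightarrow> real) \<Rightarrow> real \<Rightarrow> complex" where
  "fourier_integral f \<xi> = (LBINT x. exp (- (\<i> * complex_of_real (x * \<xi>))) * complex_of_real (f x))"

text \<open>Quadratic decay bounds the Sobolev integrand by a multiple of
  \<open>(1 + \<xi>\<^sup>2) powr (s - 2)\<close>, which is integrable for \<open>s < 3 / 2\<close>:
  this is where the upper bound on \<open>s\<close> enters. The constants \<open>B\<close> and
  \<open>K\<close> are separate so that a family of functions can share \<open>K\<close> while the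
  supports vary.\<close>

definition fourier_decay :: "real \<Rightarrow> real \<Rightarrow> (real \<Rightarrow> real) \<Rightarrow> bool" where
  "fourier_decay B K f \<longleftrightarrow> continuous_on UNIV f \<and> (\<forall>x. B < \<bar>x\<bar> \<longrightarrow> f x = 0) \<and>
     (\<forall>\<xi>. norm (fourier_integral f \<xi>) \<le> K / (1 + \<xi>\<^sup>2))"

lemma integrable_compact_support:
  fixes f :: "real \<Rightarrow> 'a::{banach, second_countable_topology}"
  assumes "continuous_on UNIV f" and "\<And>x. B < \<bar>x\<bar> \<Longrightarrow> f x = 0"
  shows "integrable lborel f"
proof -
  have "integrable lborel (\<lambda>x. indicator {-B..B} x *\<^sub>R f x)"
    by (intro borel_integrable_compact compact_Icc continuous_on_subset[OF assms(1)]) auto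
  moreover have "(\<lambda>x. indicator {-B..B} x *\<^sub>R f x) = f"
    using assms(2) by (force simp: indicator_def abs_le_iff fun_eq_iff not_le[symmetric])
  ultimately show ?thesis by simp
qed

lemma integrable_fourier_kernel:
  assumes "continuous_on UNIV f" and "\<And>x. B < \<bar>x\<bar> \<Longrightarrow> f x = 0"
  shows "integrable lborel (\<lambda>x. exp (- (\<i> * complex_of_real (x * \<xi>))) * complex_of_real (f x))"
  using assms by (intro integrable_compact_support[of _ B] continuous_intros) auto

lemma fourier_decay_diff:
  assumes "fourier_decay B K f" and "fourier_decay B K' g"
  shows "fourier_integral (\<lambda>x. f x - g x) \<xi> = fourier_integral f \<xi> - fourier_integral g \<xi>"
    and "fourier_decay B (K + K') (\<lambda>x. f x - g x)"
proof -
  have eq: "fourier_integral (\<lambda>x. f x - g x) \<xi> = fourier_integral f \<xi> - fourier_integral g \<xi>" for \<xi>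
    using assms unfolding fourier_integral_def fourier_decay_def
    by (subst Bochner_Integration.integral_diff[symmetric])
       (auto intro!: integrable_fourier_kernel[of _ B] simp: right_diff_distrib simp del: of_real_mult)
  have "norm (fourier_integral f \<xi> - fourier_integral g \<xi>) \<le> K / (1 + \<xi>\<^sup>2) + K' / (1 + \<xi>\<^sup>2)" for \<xi>
    using assms by (intro order.trans[OF norm_triangle_ineq4] add_mono) (auto simp: fourier_decay_def)
  with assms eq show "fourier_decay B (K + K') (\<lambda>x. f x - g x)"
    by (auto simp: fourier_decay_def add_divide_distrib intro!: continuous_intros)
  show "fourier_integral (\<lambda>x. f x - g x) \<xi> = fourier_integral f \<xi> - fourier_integral g \<xi>"
    by (rule eq)
qed

lemma borel_measurable_fourier_integral [measurable]:
  assumes "continuous_on UNIV f"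
  shows "fourier_integral f \<in> borel_measurable borel"
proof -
  have [measurable]: "f \<in> borel_measurable borel"
    using assms by (rule borel_measurable_continuous_onI)
  have "fourier_integral f = (\<lambda>\<xi>. LBINT x. exp (- (\<i> * complex_of_real (x * \<xi>))) * complex_of_real (f x))"
    by (simp add: fourier_integral_def fun_eq_iff)
  also have "\<dots> \<in> borel_measurable borel"
    by (intro lborel.borel_measurable_lebesgue_integral) (measurable)
  finally show ?thesis .
qed

section \<open>Integrability of the Sobolev integrand\<close>

text \<open>The weight is at most 1 on \<open>{-1..1}\<close> and at most
  \<open>\<bar>x\<bar> powr (2 * q)\<close> outside, where \<open>2 * q < -1\<close> makes both
  tails integrable; the left tail is the reflection of the right one.\<close>

lemma integrable_sobolev_weight:
  fixes q :: real
  assumes "q < - 1 / 2"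
  shows "integrable lborel (\<lambda>\<xi>. (1 + \<xi>\<^sup>2) powr q)"
proof -
  define g where "g = (\<lambda>x::real. indicator {1..} x * x powr (2 * q))"
  have "(\<lambda>x::real. x powr (2 * q)) integrable_on {1..}"
    using has_integral_powr_to_inf[of "2 * q" 1] assms by (auto simp: integrable_on_def)
  then have "(\<lambda>x::real. x powr (2 * q)) absolutely_integrable_on {1..}"
    by (intro nonnegative_absolutely_integrable_1) auto
  then have "integrable lebesgue g"
    by (simp add: g_def set_integrable_def)
  then have g: "integrable lborel g"
    by (subst (asm) integrable_completion) (auto simp: g_def)
  have g': "integrable lborel (\<lambda>x. g (- x))"
    using lborel_integrable_real_affine[OF g, of "-1" 0] by simp
  have one: "integrable lborel (\<lambda>x::real. indicator {-1..1} x *\<^sub>R (1::real))"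
    by (intro borel_integrable_compact) auto
  show ?thesis
  proof (rule Bochner_Integration.integrable_bound)
    show "integrable lborel (\<lambda>x. indicator {-1..1} x *\<^sub>R 1 + (g x + g (- x)))"
      by (intro Bochner_Integration.integrable_add one g g')
    have "(1 + x\<^sup>2) powr q \<le> indicator {-1..1} x + (g x + g (- x))" for x :: real
    proof (cases "\<bar>x\<bar> \<le> 1")
      case True
      have "(1 + x\<^sup>2) powr q \<le> (1 + x\<^sup>2) powr 0"
        using assms by (intro powr_mono) auto
      moreover have "(1 + x\<^sup>2) powr 0 = 1" using add_pos_nonneg[of 1 "x\<^sup>2"] by simp
      moreover have "0 \<le> g x" "0 \<le> g (-x)" by (auto simp: g_def)
      ultimately show ?thesis using True by (auto simp: indicator_def)
    next
      case False
      have "(1 + x\<^sup>2) powr q \<le> (\<bar>x\<bar>\<^sup>2) powr q"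
        using False assms by (intro powr_mono2') auto
      also have "\<dots> = \<bar>x\<bar> powr (2 * q)"
        using False by (subst powr_powr[symmetric]) (auto simp flip: powr_realpow)
      also have "\<dots> \<le> g x + g (- x)"
        using False by (auto simp: g_def indicator_def abs_if)
      finally show ?thesis using False by (auto simp: indicator_def)
    qed
    then show "AE x in lborel. norm ((1 + x\<^sup>2) powr q)
        \<le> norm (indicator {-1..1} x *\<^sub>R 1 + (g x + g (- x)) :: real)"
      by (auto intro!: AE_I2 order.trans[OF _ abs_ge_self])
  qed auto
qed

lemma sobolev_weight_bound:
  assumes "fourier_decay B K f"
  shows "norm ((1 + \<xi>\<^sup>2) powr s * (norm (fourier_integral f \<xi>))\<^sup>2) \<le> K\<^sup>2 * (1 + \<xi>\<^sup>2) powr (s - 2)"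
proof -
  have "(norm (fourier_integral f \<xi>))\<^sup>2 \<le> (K / (1 + \<xi>\<^sup>2))\<^sup>2"
    using assms by (intro power_mono) (auto simp: fourier_decay_def)
  then have "(1 + \<xi>\<^sup>2) powr s * (norm (fourier_integral f \<xi>))\<^sup>2
      \<le> (1 + \<xi>\<^sup>2) powr s * (K / (1 + \<xi>\<^sup>2))\<^sup>2"
    by (intro mult_left_mono) auto
  also have "\<dots> = K\<^sup>2 * (1 + \<xi>\<^sup>2) powr (s - 2)"
    using add_pos_nonneg[of 1 "\<xi>\<^sup>2"]
    by (simp add: powr_diff powr_numeral power_divide)
  finally show ?thesis by simp
qed

lemma integrable_sobolev_fourier_integral:
  assumes "fourier_decay B K f" and "s < 3 / 2"
  shows "integrable lborel (\<lambda>\<xi>. (1 + \<xi>\<^sup>2) powr s * (norm (fourier_integral f \<xi>))\<^sup>2)"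
proof (rule Bochner_Integration.integrable_bound)
  show "integrable lborel (\<lambda>\<xi>. K\<^sup>2 * (1 + \<xi>\<^sup>2) powr (s - 2))"
    using assms by (intro integrable_mult_right integrable_sobolev_weight) auto
  have [measurable]: "fourier_integral f \<in> borel_measurable borel"
    using assms by (intro borel_measurable_fourier_integral) (simp add: fourier_decay_def)
  show "(\<lambda>\<xi>. (1 + \<xi>\<^sup>2) powr s * (norm (fourier_integral f \<xi>))\<^sup>2) \<in> borel_measurable lborel"
    by measurable
qed (use sobolev_weight_bound[OF assms(1)] in \<open>auto intro!: AE_I2 order.trans[OF _ abs_ge_self]\<close>)

section \<open>Agreement with the L2 Fourier transform, and Sobolev norms\<close>

text \<open>Once \<open>[-R, R]\<close> contains the support, the truncated integral is the full
  one, so the L2 error is eventually exactly 0.\<close>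

lemma has_fourier_transform_fourier_integral:
  assumes "fourier_decay B K f"
  shows "has_fourier_transform f (fourier_integral f)"
proof -
  have cont: "continuous_on UNIV f" and supp: "\<And>x. B < \<bar>x\<bar> \<Longrightarrow> f x = 0"
    using assms by (auto simp: fourier_decay_def)
  note [measurable] = borel_measurable_fourier_integral[OF cont] borel_measurable_continuous_onI[OF cont]
  have "integrable lborel (\<lambda>x. (norm (f x))\<^sup>2)"
    using supp by (intro integrable_compact_support[of _ B] continuous_intros cont) auto
  then have f: "square_integrable f" by (simp add: square_integrable_def)
  \<comment> \<open>Square integrability of the transform is the case \<open>s = 0\<close> of the
    weighted estimate.\<close>
  have "(1 + \<xi>\<^sup>2) powr 0 = 1" for \<xi> :: real
    using add_pos_nonneg[of 1 "\<xi>\<^sup>2"] by simp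
  then have "integrable lborel (\<lambda>\<xi>. (norm (fourier_integral f \<xi>))\<^sup>2)"
    using integrable_sobolev_fourier_integral[OF assms, of 0] by simp
  then have g: "square_integrable (fourier_integral f)"
    by (simp add: square_integrable_def)
  have "(LBINT x:{-R..R}. exp (- (\<i> * complex_of_real (x * \<xi>))) * complex_of_real (f x))
      = fourier_integral f \<xi>" if "B \<le> R" for R \<xi>
    unfolding set_lebesgue_integral_def fourier_integral_def
    using supp that by (intro Bochner_Integration.integral_cong) (force simp: indicator_def)+
  then have "\<forall>\<^sub>F R in at_top. (\<integral>\<^sup>+ \<xi>. ennreal ((norm (fourier_integral f \<xi> -
          (LBINT x:{-R..R}. exp (- (\<i> * complex_of_real (x * \<xi>))) * complex_of_real (f x))))\<^sup>2)
        \<partial>lborel) = 0"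
    by (intro eventually_mono[OF eventually_ge_at_top[of B]]) simp
  then show ?thesis
    unfolding has_fourier_transform_def using f g by (auto intro: tendsto_eventually)
qed

text \<open>Uniqueness of L2 limits. The inequality
  \<open>|a - b|^2 <= 2 (|a - c|^2 + |b - c|^2)\<close>, with the truncated integral as
  \<open>c\<close>, replaces the triangle inequality for the L2 norm and can be integrated directly
  in \<open>ennreal\<close>.\<close>

lemma has_fourier_transform_AE_unique:
  assumes g: "has_fourier_transform f g" and g': "has_fourier_transform f g'"
    and f: "continuous_on UNIV f"
  shows "AE \<xi> in lborel. g \<xi> = g' \<xi>"
proof -
  define F where "F = (\<lambda>R \<xi>. LBINT x:{-R..R}. exp (- (\<i> * complex_of_real (x * \<xi>))) * complex_of_real (f x))"
  have [measurable]: "f \<in> borel_measurable borel"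
    using f by (rule borel_measurable_continuous_onI)
  have [measurable]: "F R \<in> borel_measurable borel" for R
    unfolding F_def set_lebesgue_integral_def
    by (intro lborel.borel_measurable_lebesgue_integral) (measurable)
  have [measurable]: "g \<in> borel_measurable borel" "g' \<in> borel_measurable borel"
    using g g' by (auto simp: has_fourier_transform_def square_integrable_def)
  define E where "E = (\<lambda>h R. \<integral>\<^sup>+ \<xi>. ennreal ((norm (h \<xi> - F R \<xi>))\<^sup>2) \<partial>lborel)"
  have lim: "(E g \<longlongrightarrow> 0) at_top" "(E g' \<longlongrightarrow> 0) at_top"
    using g g' by (auto simp: has_fourier_transform_def E_def F_def)
  have "(\<integral>\<^sup>+ \<xi>. ennreal ((norm (g \<xi> - g' \<xi>))\<^sup>2) \<partial>lborel) \<le> 2 * (E g R + E g' R)" for R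
  proof -
    have "ennreal ((norm (g \<xi> - g' \<xi>))\<^sup>2)
        \<le> 2 * (ennreal ((norm (g \<xi> - F R \<xi>))\<^sup>2) + ennreal ((norm (g' \<xi> - F R \<xi>))\<^sup>2))" for \<xi>
    proof -
      have "norm (g \<xi> - g' \<xi>) \<le> norm (g \<xi> - F R \<xi>) + norm (g' \<xi> - F R \<xi>)"
        by (metis norm_triangle_ineq4 diff_diff_eq2 diff_add_cancel)
      then have "(norm (g \<xi> - g' \<xi>))\<^sup>2 \<le> (norm (g \<xi> - F R \<xi>) + norm (g' \<xi> - F R \<xi>))\<^sup>2"
        by (intro power_mono) auto
      also have "\<dots> \<le> 2 * ((norm (g \<xi> - F R \<xi>))\<^sup>2 + (norm (g' \<xi> - F R \<xi>))\<^sup>2)"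
        using sum_squares_bound[of "norm (g \<xi> - F R \<xi>)" "norm (g' \<xi> - F R \<xi>)"]
        by (simp add: power2_sum)
      finally have "ennreal ((norm (g \<xi> - g' \<xi>))\<^sup>2)
          \<le> ennreal (2 * ((norm (g \<xi> - F R \<xi>))\<^sup>2 + (norm (g' \<xi> - F R \<xi>))\<^sup>2))"
        by (rule ennreal_leI)
      then show ?thesis
        by (simp add: ennreal_mult ennreal_plus)
    qed
    then have "(\<integral>\<^sup>+ \<xi>. ennreal ((norm (g \<xi> - g' \<xi>))\<^sup>2) \<partial>lborel)
      \<le> (\<integral>\<^sup>+ \<xi>. 2 * (ennreal ((norm (g \<xi> - F R \<xi>))\<^sup>2) + ennreal ((norm (g' \<xi> - F R \<xi>))\<^sup>2)) \<partial>lborel)"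
      by (intro nn_integral_mono)
    also have "\<dots> = 2 * (E g R + E g' R)"
      unfolding E_def by (subst nn_integral_cmult) (auto simp: nn_integral_add)
    finally show ?thesis .
  qed
  moreover have "((\<lambda>R. 2 * (E g R + E g' R)) \<longlongrightarrow> 2 * (0 + 0)) at_top"
    by (intro tendsto_add ennreal_tendsto_cmult lim) auto
  ultimately have "(\<integral>\<^sup>+ \<xi>. ennreal ((norm (g \<xi> - g' \<xi>))\<^sup>2) \<partial>lborel) \<le> 2 * (0 + 0)"
    by (intro tendsto_lowerbound[where F=at_top]) auto
  then have "AE \<xi> in lborel. ennreal ((norm (g \<xi> - g' \<xi>))\<^sup>2) = 0"
    by (subst nn_integral_0_iff_AE[symmetric]) auto
  then show ?thesis by eventually_elim simp
qed

lemma fourier_decay_in_sobolev_space: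
  assumes "fourier_decay B K f" and "s < 3 / 2"
  shows "f \<in> sobolev_space s"
  unfolding sobolev_space_def
  using has_fourier_transform_fourier_integral integrable_sobolev_fourier_integral assms by blast

text \<open>A transform exists, so the one picked by \<open>SOME\<close> is a transform; by
  uniqueness it differs from the Fourier integral only on a null set, which the norm does not
  see.\<close>

lemma sobolev_norm_fourier_integral:
  assumes "fourier_decay B K f"
  shows "sobolev_norm s f = sqrt (LBINT \<xi>. (1 + \<xi>\<^sup>2) powr s * (norm (fourier_integral f \<xi>))\<^sup>2)"
proof -
  have f: "continuous_on UNIV f" using assms by (simp add: fourier_decay_def)
  have *: "has_fourier_transform f (fourier_integral f)"
    by (rule has_fourier_transform_fourier_integral[OF assms])
  then have **: "has_fourier_transform f (fourier_transform f)"
    unfolding fourier_transform_def by (rule someI[where P="has_fourier_transform f"])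
  then have [measurable]: "fourier_transform f \<in> borel_measurable borel"
    by (auto simp: has_fourier_transform_def square_integrable_def)
  note [measurable] = borel_measurable_fourier_integral[OF f]
  have "AE \<xi> in lborel. fourier_transform f \<xi> = fourier_integral f \<xi>"
    by (rule has_fourier_transform_AE_unique[OF ** * f])
  then show ?thesis
    unfolding sobolev_norm_def
    by (intro arg_cong[where f=sqrt] integral_cong_AE) (auto elim!: eventually_mono)
qed

text \<open>The common \<open>K\<close> supplies the dominating function. This serves both
  continuity in time and smallness of the initial norm; convergence almost everywhere lets the
  former leave out \<open>\<xi> = 0\<close>, where the formula for tents divides by zero.\<close>

lemma sobolev_norm_dominated_convergence:
  assumes f: "\<And>n::nat. fourier_decay (B n) K (f n)" and "s < 3 / 2"
    and lim: "AE \<xi> in lborel. (\<lambda>n. fourier_integral (f n) \<xi>) \<longlonglongrightarrow> 0"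
  shows "(\<lambda>n. sobolev_norm s (f n)) \<longlonglongrightarrow> 0"
proof -
  have [measurable]: "fourier_integral (f n) \<in> borel_measurable borel" for n
    using f by (intro borel_measurable_fourier_integral) (simp add: fourier_decay_def)
  have "(\<lambda>n. LBINT \<xi>. (1 + \<xi>\<^sup>2) powr s * (norm (fourier_integral (f n) \<xi>))\<^sup>2)
      \<longlonglongrightarrow> integral\<^sup>L lborel (\<lambda>_::real. 0::real)"
  proof (rule integral_dominated_convergence)
    show "integrable lborel (\<lambda>\<xi>. K\<^sup>2 * (1 + \<xi>\<^sup>2) powr (s - 2))"
      using assms by (intro integrable_mult_right integrable_sobolev_weight) auto
    show "AE \<xi> in lborel. (\<lambda>n. (1 + \<xi>\<^sup>2) powr s * (norm (fourier_integral (f n) \<xi>))\<^sup>2) \<longlonglongrightarrow> 0"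
      using lim by eventually_elim (auto intro!: tendsto_eq_intros)
    show "AE \<xi> in lborel. norm ((1 + \<xi>\<^sup>2) powr s * (norm (fourier_integral (f n) \<xi>))\<^sup>2)
        \<le> K\<^sup>2 * (1 + \<xi>\<^sup>2) powr (s - 2)" for n
      by (intro AE_I2 sobolev_weight_bound[OF f])
  qed auto
  then have "(\<lambda>n. sqrt (LBINT \<xi>. (1 + \<xi>\<^sup>2) powr s * (norm (fourier_integral (f n) \<xi>))\<^sup>2))
      \<longlonglongrightarrow> sqrt 0"
    by (intro tendsto_real_sqrt) simp
  then show ?thesis
    by (simp add: sobolev_norm_fourier_integral[OF f])
qed

section \<open>Tents and their Fourier integrals\<close>

text \<open>Both quotients are 1 at the peak \<open>p\<close>; the minimum selects the correct side
  and the maximum cuts off outside \<open>[-b, b]\<close>. In this form continuity is immediate,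
  without gluing cases.\<close>

definition tent :: "real \<Rightarrow> real \<Rightarrow> real \<Rightarrow> real \<Rightarrow> real" where
  "tent b h p x = h * max 0 (min ((x + b) / (b + p)) ((b - x) / (b - p)))"

lemma continuous_on_tent [continuous_intros]:
  "continuous_on S f \<Longrightarrow> continuous_on S (\<lambda>x. tent b h p (f x))"
  unfolding tent_def divide_inverse by (intro continuous_intros)

context
  fixes b h p :: real
  assumes p: "\<bar>p\<bar> < b" and h: "0 \<le> h"
begin

lemma tent_left: "-b \<le> x \<Longrightarrow> x \<le> p \<Longrightarrow> tent b h p x = h * (x + b) / (b + p)"
proof -
  assume x: "-b \<le> x" "x \<le> p"
  \<comment> \<open>Comparing both quotients with 1, their common value at the peak, decides the
    minimum.\<close>
  have "(x + b) / (b + p) \<le> 1" "1 \<le> (b - x) / (b - p)" "0 \<le> (x + b) / (b + p)"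
    using x p by (auto simp: divide_simps)
  then show ?thesis by (simp add: tent_def min_def max_def)
qed

lemma tent_right: "p \<le> x \<Longrightarrow> x \<le> b \<Longrightarrow> tent b h p x = h * (b - x) / (b - p)"
proof -
  assume x: "p \<le> x" "x \<le> b"
  have "1 \<le> (x + b) / (b + p)" "(b - x) / (b - p) \<le> 1" "0 \<le> (b - x) / (b - p)"
    using x p by (auto simp: divide_simps)
  then show ?thesis by (simp add: tent_def min_absorb2)
qed

lemma tent_outside: "b < \<bar>x\<bar> \<Longrightarrow> tent b h p x = 0"
proof -
  assume x: "b < \<bar>x\<bar>"
  have "(x + b) / (b + p) < 0 \<or> (b - x) / (b - p) < 0"
    using x p by (auto simp: divide_less_0_iff)
  then show ?thesis by (auto simp: tent_def)
qed

lemma tent_bounds: "0 \<le> tent b h p x" "tent b h p x \<le> h"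
proof -
  have "min ((x + b) / (b + p)) ((b - x) / (b - p)) \<le> 1"
    using p by (cases "x \<le> p") (auto simp: min_le_iff_disj divide_simps)
  then have "max 0 (min ((x + b) / (b + p)) ((b - x) / (b - p))) \<le> 1" by simp
  then show "tent b h p x \<le> h"
    unfolding tent_def using h by (rule mult_left_le)
  show "0 \<le> tent b h p x" using h by (simp add: tent_def)
qed

text \<open>Passes from the Lebesgue integral over the line to gauge integrals over the two
  intervals on which the tent is affine, where the fundamental theorem and substitution
  apply.\<close>

lemma integral_split_at_peak:
  fixes g :: "real \<Rightarrow> 'a::euclidean_space"
  assumes g: "continuous_on UNIV g" and supp: "\<And>x. b < \<bar>x\<bar> \<Longrightarrow> g x = 0"
  shows "integral\<^sup>L lborel g = integral {-b..p} g + integral {p..b} g"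
proof -
  have "integral\<^sup>L lborel g = (LBINT x:{-b..b}. g x)"
    unfolding set_lebesgue_integral_def using supp
    by (intro Bochner_Integration.integral_cong) (force simp: indicator_def)+
  also have "\<dots> = integral {-b..b} g"
    by (intro set_borel_integral_eq_integral(2) borel_integrable_atLeastAtMost'
        continuous_on_subset[OF g]) auto
  also have "\<dots> = integral {-b..p} g + integral {p..b} g"
    using p by (intro Henstock_Kurzweil_Integration.integral_combine[symmetric]
        integrable_continuous_interval continuous_on_subset[OF g]) auto
  finally show ?thesis .
qed

end

text \<open>\<open>F\<close> is the antiderivative that integration by parts produces.\<close>

lemma integral_linear_times_character:
  fixes \<xi> A B a c :: real
  defines "F \<equiv> \<lambda>x::real. exp (- (\<i> * complex_of_real (x * \<xi>))) *
     (\<i> * complex_of_real (A * x + B) / of_real \<xi> + of_real A / (of_real \<xi>)\<^sup>2)"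
  assumes "\<xi> \<noteq> 0" and "a \<le> c"
  shows "integral {a..c} (\<lambda>x. exp (- (\<i> * complex_of_real (x * \<xi>))) * complex_of_real (A * x + B))
    = F c - F a"
proof (rule integral_unique, rule fundamental_theorem_of_calculus)
  fix x :: real
  \<comment> \<open>The derivative is taken in a complex variable and then restricted to the real
    line.\<close>
  have "((\<lambda>z. exp (- (\<i> * (z * of_real \<xi>))) * (\<i> * (of_real A * z + of_real B) / of_real \<xi>
        + of_real A / (of_real \<xi>)\<^sup>2)) has_field_derivative
      exp (- (\<i> * complex_of_real (x * \<xi>))) * complex_of_real (A * x + B)) (at (of_real x))"
    using \<open>\<xi> \<noteq> 0\<close> by (auto intro!: derivative_eq_intros simp: field_simps power2_eq_square)
  from has_vector_derivative_real_field[OF this, of "{a..c}"]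
  show "(F has_vector_derivative
     exp (- (\<i> * complex_of_real (x * \<xi>))) * complex_of_real (A * x + B)) (at x within {a..c})"
    by (simp add: F_def o_def)
qed (use assms in auto)

context
  fixes b h p :: real
  assumes p: "\<bar>p\<bar> < b" and h: "0 \<le> h"
begin

text \<open>Integrate by parts on each side of the peak. The terms of order \<open>1 / \<xi>\<close>
  vanish at the ends of the base, where the tent is 0, and cancel at the peak, where both sides have
  the value \<open>h\<close>. What remains are the jumps of the slope at \<open>-b\<close>,
  \<open>p\<close> and \<open>b\<close>, with opposite sign, over the square of \<xi>.\<close>

lemma fourier_integral_tent:
  assumes "\<xi> \<noteq> 0"
  shows "fourier_integral (tent b h p) \<xi> =
    (complex_of_real (h / (b + p) + h / (b - p)) * exp (- (\<i> * complex_of_real (p * \<xi>)))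
      - complex_of_real (h / (b + p)) * exp (- (\<i> * complex_of_real (- b * \<xi>)))
      - complex_of_real (h / (b - p)) * exp (- (\<i> * complex_of_real (b * \<xi>)))) / (of_real \<xi>)\<^sup>2"
proof -
  define e where "e = (\<lambda>x. exp (- (\<i> * complex_of_real (x * \<xi>))))"
  define \<alpha> \<beta> where "\<alpha> = h / (b + p)" and "\<beta> = h / (b - p)"
  have ne: "b + p \<noteq> 0" "b - p \<noteq> 0" using p by auto
  have "fourier_integral (tent b h p) \<xi> = integral {-b..p} (\<lambda>x. e x * complex_of_real (tent b h p x))
      + integral {p..b} (\<lambda>x. e x * complex_of_real (tent b h p x))"
    unfolding fourier_integral_def e_def using tent_outside[OF p h]
    by (intro integral_split_at_peak[OF p h] continuous_intros) auto
  also have "integral {-b..p} (\<lambda>x. e x * complex_of_real (tent b h p x))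
      = integral {-b..p} (\<lambda>x. e x * complex_of_real (\<alpha> * x + \<alpha> * b))"
    by (intro integral_cong) (auto simp: tent_left[OF p h] \<alpha>_def add_divide_distrib ring_distribs)
  also have "\<dots> = e p * (\<i> * complex_of_real (\<alpha> * p + \<alpha> * b) / of_real \<xi> + of_real \<alpha> / (of_real \<xi>)\<^sup>2)
      - e (-b) * (\<i> * complex_of_real (\<alpha> * (-b) + \<alpha> * b) / of_real \<xi> + of_real \<alpha> / (of_real \<xi>)\<^sup>2)"
    unfolding e_def using p assms by (intro integral_linear_times_character) auto
  also have "\<alpha> * p + \<alpha> * b = h" using ne by (simp add: \<alpha>_def add.commute[of p] flip: distrib_left add_divide_distrib)
  also have "integral {p..b} (\<lambda>x. e x * complex_of_real (tent b h p x))
      = integral {p..b} (\<lambda>x. e x * complex_of_real (- \<beta> * x + \<beta> * b))"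
    by (intro integral_cong) (auto simp: tent_right[OF p h] \<beta>_def diff_divide_distrib ring_distribs)
  also have "\<dots> = e b * (\<i> * complex_of_real (- \<beta> * b + \<beta> * b) / of_real \<xi> + of_real (- \<beta>) / (of_real \<xi>)\<^sup>2)
      - e p * (\<i> * complex_of_real (- \<beta> * p + \<beta> * b) / of_real \<xi> + of_real (- \<beta>) / (of_real \<xi>)\<^sup>2)"
    unfolding e_def using p assms by (intro integral_linear_times_character) auto
  also have "- \<beta> * p + \<beta> * b = h" using ne by (simp add: \<beta>_def flip: right_diff_distrib diff_divide_distrib)
  finally have "fourier_integral (tent b h p) \<xi>
     = (complex_of_real (\<alpha> + \<beta>) * e p - complex_of_real \<alpha> * e (- b) - complex_of_real \<beta> * e b)
       / (of_real \<xi>)\<^sup>2"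
    by (simp add: algebra_simps add_divide_distrib diff_divide_distrib)
  then show ?thesis by (simp only: e_def \<alpha>_def \<beta>_def)
qed

text \<open>The L1 norm is at most the length of the base times the height. This controls low
  frequencies, where the explicit formula is of no use, and it tends to 0 for shrinking
  tents.\<close>

lemma norm_fourier_integral_tent_le: "norm (fourier_integral (tent b h p) \<xi>) \<le> 2 * b * h"
proof -
  have "norm (fourier_integral (tent b h p) \<xi>) \<le> (LBINT x. tent b h p x)"
    unfolding fourier_integral_def using tent_bounds[OF p h] tent_outside[OF p h]
    by (intro order.trans[OF integral_norm_bound] eq_refl Bochner_Integration.integral_cong)
       (auto simp: norm_mult)
  also have "\<dots> \<le> (LBINT x. indicator {-b..b} x *\<^sub>R h)"
    using tent_bounds[OF p h] tent_outside[OF p h]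
    by (intro integral_mono integrable_compact_support[of "tent b h p" b]
         borel_integrable_compact continuous_intros) (force simp: indicator_def)+
  also have "\<dots> = 2 * b * h" using p by simp
  finally show ?thesis .
qed

text \<open>The constant is the sum of the L1 bound and a bound for \<open>\<xi>\<^sup>2\<close>
  times the transform: the three exponentials are unimodular, and their coefficients have absolute
  values adding up to twice the sum of the two slopes.\<close>

lemma fourier_decay_tent:
  "fourier_decay b (2 * b * h + 2 * (h / (b + p) + h / (b - p))) (tent b h p)"
proof -
  have "norm (fourier_integral (tent b h p) \<xi>) * \<xi>\<^sup>2 \<le> 2 * (h / (b + p) + h / (b - p))" for \<xi>
  proof (cases "\<xi> = 0")
    case False
    have pos: "0 \<le> h / (b + p)" "0 \<le> h / (b - p)" using p h by auto
    have unit: "norm (exp (- (\<i> * complex_of_real x))) = 1" for x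
      by simp
    have "norm (complex_of_real (h / (b + p) + h / (b - p)) * exp (- (\<i> * complex_of_real (p * \<xi>)))
      - complex_of_real (h / (b + p)) * exp (- (\<i> * complex_of_real (- b * \<xi>)))
      - complex_of_real (h / (b - p)) * exp (- (\<i> * complex_of_real (b * \<xi>))))
      \<le> (h / (b + p) + h / (b - p)) + h / (b + p) + h / (b - p)"
      using pos by (intro order.trans[OF norm_triangle_ineq4] add_mono)
        (simp_all only: norm_mult unit norm_of_real, simp_all)
    then show ?thesis
      using False by (simp add: fourier_integral_tent norm_divide norm_power del: of_real_mult of_real_add of_real_divide of_real_diff)
  qed (use p h in auto)
  then have "norm (fourier_integral (tent b h p) \<xi>) * (1 + \<xi>\<^sup>2)
      \<le> 2 * b * h + 2 * (h / (b + p) + h / (b - p))" for \<xi>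
    using norm_fourier_integral_tent_le[of \<xi>] by (simp add: ring_distribs add_mono)
  moreover have "0 < 1 + \<xi>\<^sup>2" for \<xi> :: real by (simp add: add_pos_nonneg)
  ultimately show ?thesis
    unfolding fourier_decay_def using tent_outside[OF p h]
    by (auto simp: pos_le_divide_eq intro: continuous_intros)
qed

end

section \<open>The weak formulation along characteristics\<close>

text \<open>Partial derivatives, one of them continuous, give the total derivative. It is needed for
  the chain rule along the characteristics.\<close>

lemma has_derivative_of_cont_diff:
  assumes "k_times_cont_diff (Suc k) \<phi>"
  shows "(\<phi> has_derivative (\<lambda>(dt, dx). dt * partial_t \<phi> (t, x) + dx * partial_x \<phi> (t, x))) (at (t, x))"
proof -
  have cont: "continuous_on UNIV (partial_x \<phi>)"
    using assms by (cases k) auto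
  have dt: "((\<lambda>\<tau>. \<phi> (\<tau>, x)) has_real_derivative partial_t \<phi> (t, x)) (at t)" for t x
    using assms by (auto simp: partial_t_def DERIV_deriv_iff_real_differentiable)
  have dx: "((\<lambda>y. \<phi> (t, y)) has_real_derivative partial_x \<phi> (t, x)) (at x)" for t x
    using assms by (auto simp: partial_x_def DERIV_deriv_iff_real_differentiable)
  have "((\<lambda>(t, x). \<phi> (t, x)) has_derivative
      (\<lambda>(dt, dx). partial_t \<phi> (t, x) * dt + blinfun_mult_right (partial_x \<phi> (t, x)) dx))
      (at (t, x) within UNIV \<times> UNIV)"
  proof (rule has_derivative_partialsI)
    show "((\<lambda>t. \<phi> (t, x)) has_derivative (*) (partial_t \<phi> (t, x))) (at t within UNIV)"
      using dt by (simp add: has_field_derivative_def)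
    show "((\<lambda>x. \<phi> (t, x)) has_derivative blinfun_apply (blinfun_mult_right (partial_x \<phi> (t, x))))
        (at x within UNIV)" for t x
      using dx by (simp add: has_field_derivative_def)
    have "continuous_on UNIV (\<lambda>p. blinfun_mult_right (partial_x \<phi> p))"
      by (intro continuous_intros cont)
    then show "continuous (at (t, x) within UNIV \<times> UNIV) (\<lambda>(t, x). blinfun_mult_right (partial_x \<phi> (t, x)))"
      by (simp add: continuous_on_eq_continuous_at case_prod_unfold del: split_paired_All)
  qed auto
  then show ?thesis by (simp add: mult.commute split_beta)
qed

text \<open>
  With \<open>y\<close> the fraction of the peak height, \<open>c + y (h t - c)\<close> is the characteristic carrying the
  value \<open>h y\<close>. In the coordinates \<open>(t, y)\<close> the weak formulation on one side of the peak is the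
  divergence of the field with time component \<open>h y (h t - c) \<phi>\<close> and \<open>y\<close>-component \<open>- (h y)\<^sup>2 / 2 \<phi>\<close>.
\<close>

lemma
  fixes c h :: real
  assumes \<phi>: "k_times_cont_diff (Suc k) \<phi>"
  defines "J \<equiv> \<lambda>t. integral {0..1} (\<lambda>y. (h * t - c) *
      (h * y * partial_t \<phi> (t, c + y * (h * t - c)) + (h * y)\<^sup>2 / 2 * partial_x \<phi> (t, c + y * (h * t - c))))"
  shows integral_characteristics_derivative:
      "((\<lambda>t. integral {0..1} (\<lambda>y. h * y * (h * t - c) * \<phi> (t, c + y * (h * t - c))))
        has_real_derivative J t + h\<^sup>2 / 2 * \<phi> (t, h * t)) (at t)"
    and continuous_on_integral_characteristics: "continuous_on UNIV J"
proof -
  have cont: "continuous_on UNIV \<phi>" "continuous_on UNIV (partial_t \<phi>)" "continuous_on UNIV (partial_x \<phi>)"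
    using \<phi> by (cases k; auto)+
  note [continuous_intros] = cont[THEN continuous_on_compose2]
  define X where "X = (\<lambda>t y. c + y * (h * t - c))"
  define G where "G = (\<lambda>t y. h * y * (h * t - c) * \<phi> (t, X t y))"
  \<comment> \<open>\<open>H\<close> is the time derivative of \<open>G\<close>, \<open>W\<close> is
    the \<open>y\<close>-derivative of the flux \<open>(h * y)\<^sup>2 / 2 * \<phi>\<close>, and
    \<open>j\<close> is the integrand of \<open>J\<close>. The proof rests on the pointwise identity
    \<open>H = j + W\<close>.\<close>
  define H where "H = (\<lambda>t y. h * y * (h * t - c) * (partial_t \<phi> (t, X t y) + h * y * partial_x \<phi> (t, X t y))
      + h\<^sup>2 * y * \<phi> (t, X t y))"
  define W where "W = (\<lambda>t y. h\<^sup>2 * y * \<phi> (t, X t y) + (h * y)\<^sup>2 / 2 * ((h * t - c) * partial_x \<phi> (t, X t y)))"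
  define j where "j = (\<lambda>t y. (h * t - c) * (h * y * partial_t \<phi> (t, X t y) + (h * y)\<^sup>2 / 2 * partial_x \<phi> (t, X t y)))"
  have J: "J = (\<lambda>t. integral {0..1} (j t))" by (simp add: J_def j_def X_def)
  have "continuous_on UNIV (\<lambda>t. integral (cbox 0 1) (j t))"
    unfolding j_def X_def split_beta
    by (intro integral_continuous_on_param) (auto simp: split_beta intro!: continuous_intros)
  then show "continuous_on UNIV J" by (simp add: J)
  have dG: "((\<lambda>t. G t y) has_real_derivative H t y) (at t)" for t y
  proof -
    have X: "((\<lambda>t. (t, X t y)) has_derivative (\<lambda>d. (d, d * (h * y)))) (at t)"
      unfolding X_def by (auto intro!: derivative_eq_intros simp: algebra_simps)
    have "((\<lambda>t. \<phi> (t, X t y)) has_real_derivative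
        partial_t \<phi> (t, X t y) + h * y * partial_x \<phi> (t, X t y)) (at t)"
      unfolding has_field_derivative_def
      by (rule has_derivative_eq_rhs[OF has_derivative_compose[OF X has_derivative_of_cont_diff[OF \<phi>]]])
         (simp add: fun_eq_iff algebra_simps)
    then show ?thesis
      unfolding G_def H_def
      by (auto intro!: derivative_eq_intros simp: algebra_simps power2_eq_square)
  qed
  have dW: "((\<lambda>y. (h * y)\<^sup>2 / 2 * \<phi> (t, X t y)) has_real_derivative W t y) (at y)" for y
  proof -
    have X: "((\<lambda>y. (t, X t y)) has_derivative (\<lambda>d. (0, d * (h * t - c)))) (at y)"
      unfolding X_def by (auto intro!: derivative_eq_intros simp: algebra_simps)
    have "((\<lambda>y. \<phi> (t, X t y)) has_real_derivative (h * t - c) * partial_x \<phi> (t, X t y)) (at y)"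
      unfolding has_field_derivative_def
      by (rule has_derivative_eq_rhs[OF has_derivative_compose[OF X has_derivative_of_cont_diff[OF \<phi>]]])
         (simp add: fun_eq_iff algebra_simps)
    then show ?thesis
      unfolding W_def by (auto intro!: derivative_eq_intros simp: field_simps power2_eq_square)
  qed
  have "((\<lambda>t. integral (cbox 0 1) (G t)) has_real_derivative integral (cbox 0 1) (H t)) (at t within UNIV)"
    using dG by (intro leibniz_rule_field_derivative)
      (auto simp: G_def H_def X_def split_beta intro!: continuous_intros integrable_continuous_interval)
  moreover have "integral (cbox 0 1) (H t) = J t + h\<^sup>2 / 2 * \<phi> (t, h * t)"
  proof -
    \<comment> \<open>The flux vanishes at \<open>y = 0\<close>, and \<open>y = 1\<close> is the
      peak \<open>h * t\<close> whatever \<open>c\<close> is. The boundary term is therefore the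
      same for both sides of the tent.\<close>
    have "(W t has_integral ((h * 1)\<^sup>2 / 2 * \<phi> (t, X t 1) - (h * 0)\<^sup>2 / 2 * \<phi> (t, X t 0))) {0..1}"
      using dW by (intro fundamental_theorem_of_calculus)
        (auto simp flip: has_real_derivative_iff_has_vector_derivative intro: has_field_derivative_at_within)
    then have W: "(W t has_integral (h\<^sup>2 / 2 * \<phi> (t, h * t))) {0..1}" by (simp add: X_def)
    have "j t integrable_on {0..1}"
      unfolding j_def X_def by (auto intro!: continuous_intros integrable_continuous_interval)
    then have "(j t has_integral J t) {0..1}" by (auto simp: J)
    from has_integral_add[OF this W]
    have "((\<lambda>y. j t y + W t y) has_integral (J t + h\<^sup>2 / 2 * \<phi> (t, h * t))) {0..1}" .
    moreover have "H t = (\<lambda>y. j t y + W t y)"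
      by (simp add: fun_eq_iff H_def j_def W_def field_simps power2_eq_square)
    ultimately show ?thesis by (simp add: integral_unique)
  qed
  ultimately show "((\<lambda>t. integral {0..1} (\<lambda>y. h * y * (h * t - c) * \<phi> (t, c + y * (h * t - c))))
        has_real_derivative J t + h\<^sup>2 / 2 * \<phi> (t, h * t)) (at t)"
    by (simp add: G_def X_def)
qed

text \<open>The spatial integral is the difference of the terms \<open>J\<close> for the feet
  \<open>-b\<close> and \<open>b\<close>. Their boundary terms at the peak cancel, so this
  difference is the time derivative of \<open>G (-b) - G b\<close>, which vanishes at both end times
  because the test function does.\<close>

lemma burgers_distributional_tent:
  assumes h: "0 < h" and T: "0 \<le> T" and b: "h * T < b"
  shows "burgers_distributional T (\<lambda>t. tent b h (h * t))"
  unfolding burgers_distributional_def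
proof
  fix \<phi> assume test: "\<phi> \<in> test_functions ({0<..<T} \<times> UNIV)"
  have \<phi>: "k_times_cont_diff (Suc 0) \<phi>" using test unfolding test_functions_def by blast
  have cont: "continuous_on UNIV \<phi>" "continuous_on UNIV (partial_t \<phi>)" "continuous_on UNIV (partial_x \<phi>)"
    using \<phi> by auto
  note [continuous_intros] = cont[THEN continuous_on_compose2]
  have zero: "\<phi> (t, x) = 0" if "t \<le> 0 \<or> T \<le> t" for t x
  proof (rule ccontr)
    assume "\<phi> (t, x) \<noteq> 0"
    then have "(t, x) \<in> closure {p. \<phi> p \<noteq> 0}"
      by (intro subsetD[OF closure_subset]) simp
    also have "\<dots> \<subseteq> {0<..<T} \<times> UNIV" using test unfolding test_functions_def by blast
    finally show False using that by auto
  qed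
  define J where "J = (\<lambda>c t. integral {0..1} (\<lambda>y. (h * t - c) *
      (h * y * partial_t \<phi> (t, c + y * (h * t - c)) + (h * y)\<^sup>2 / 2 * partial_x \<phi> (t, c + y * (h * t - c)))))"
  define G where "G = (\<lambda>c t. integral {0..1} (\<lambda>y. h * y * (h * t - c) * \<phi> (t, c + y * (h * t - c))))"
  have dG: "(G c has_real_derivative J c t + h\<^sup>2 / 2 * \<phi> (t, h * t)) (at t)" for c t
    unfolding G_def J_def by (rule integral_characteristics_derivative[OF \<phi>])
  have cJ: "continuous_on UNIV (J c)" for c
    unfolding J_def by (rule continuous_on_integral_characteristics[OF \<phi>])
  \<comment> \<open>For the foot \<open>b\<close> the parameter \<open>y\<close> runs leftwards to
    the peak, so the Jacobian \<open>h * t - b\<close> is negative and \<open>J b t\<close> enters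
    with a minus sign.\<close>
  have inner: "(LBINT x. tent b h (h * t) x * partial_t \<phi> (t, x)
        + (tent b h (h * t) x)\<^sup>2 / 2 * partial_x \<phi> (t, x)) = J (-b) t - J b t"
    if t: "t \<in> {0<..<T}" for t
  proof -
    have "h * t < h * T" "0 < h * t" using t h by auto
    then have p: "\<bar>h * t\<bar> < b" using b by auto
    note h' = less_imp_le[OF h]
    define g where "g = (\<lambda>x. tent b h (h * t) x * partial_t \<phi> (t, x)
        + (tent b h (h * t) x)\<^sup>2 / 2 * partial_x \<phi> (t, x))"
    have cg: "continuous_on S g" for S
      unfolding g_def by (auto intro!: continuous_intros)
    have "integral\<^sup>L lborel g = integral {-b..h * t} g + integral {h * t..b} g"
      by (intro integral_split_at_peak[OF p h'] cg) (simp add: g_def tent_outside[OF p h'])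
    also have "integral {-b..h * t} g = J (-b) t"
    proof -
      let ?X = "\<lambda>y. - b + y * (h * t - - b)"
      have X: "?X y \<in> {-b..h * t}" if "y \<in> {0..1}" for y
      proof -
        have "y * (h * t - - b) \<le> 1 * (h * t - - b)" "0 \<le> y * (h * t - - b)"
          using that p by (intro mult_right_mono mult_nonneg_nonneg; auto)+
        then show ?thesis by auto
      qed
      have sub: "((\<lambda>y. (h * t - - b) *\<^sub>R g (?X y)) has_integral
          (integral {?X 0..?X 1} g - integral {?X 1..?X 0} g)) {0..1}"
        by (rule has_integral_substitution_general[OF finite.emptyI, where c="-b" and d="h * t"])
           (use X in \<open>auto intro!: cg continuous_intros derivative_eq_intros\<close>)
      have tent: "tent b h (h * t) (?X y) = h * y" if "y \<in> {0..1}" for y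
      proof -
        have "tent b h (h * t) (?X y) = h * (?X y + b) / (b + h * t)"
          using X[OF that] by (intro tent_left[OF p h']) auto
        also have "\<dots> = h * y" using p by (auto simp: add.commute)
        finally show ?thesis .
      qed
      \<comment> \<open>The substitution rule subtracts the two orientations of the interval; here
        the second interval is empty, and on the right of the peak the first one is.\<close>
      have "integral {-b..h * t} g = (integral {?X 0..?X 1} g - integral {?X 1..?X 0} g)"
        using p by simp
      also have "\<dots> = integral {0..1} (\<lambda>y. (h * t - - b) *\<^sub>R g (?X y))"
        by (simp only: integral_unique[OF sub])
      also have "\<dots> = J (-b) t"
        unfolding J_def by (intro integral_cong) (simp only: g_def tent real_scaleR_def)
      finally show ?thesis .
    qed
    also have "integral {h * t..b} g = - J b t"
    proof -
      let ?X = "\<lambda>y. b + y * (h * t - b)"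
      have X: "?X y \<in> {h * t..b}" if "y \<in> {0..1}" for y
      proof -
        have "y * (b - h * t) \<le> 1 * (b - h * t)" "0 \<le> y * (b - h * t)"
          using that p by (intro mult_right_mono mult_nonneg_nonneg; auto)+
        then show ?thesis by (auto simp: algebra_simps)
      qed
      have sub: "((\<lambda>y. (h * t - b) *\<^sub>R g (?X y)) has_integral
          (integral {?X 0..?X 1} g - integral {?X 1..?X 0} g)) {0..1}"
        by (rule has_integral_substitution_general[OF finite.emptyI, where c="h * t" and d="b"])
           (use X in \<open>auto intro!: cg continuous_intros derivative_eq_intros\<close>)
      have tent: "tent b h (h * t) (?X y) = h * y" if "y \<in> {0..1}" for y
      proof -
        have "tent b h (h * t) (?X y) = h * (b - ?X y) / (b - h * t)"
          using X[OF that] by (intro tent_right[OF p h']) auto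
        also have "b - ?X y = y * (b - h * t)" by (simp add: algebra_simps)
        finally show ?thesis using p by simp
      qed
      have "integral {h * t..b} g = - (integral {?X 0..?X 1} g - integral {?X 1..?X 0} g)"
        using p by simp
      also have "\<dots> = - integral {0..1} (\<lambda>y. (h * t - b) *\<^sub>R g (?X y))"
        by (simp only: integral_unique[OF sub])
      also have "\<dots> = - J b t"
        unfolding J_def by (intro integral_cong arg_cong[where f=uminus]) (simp only: g_def tent real_scaleR_def)
      finally show ?thesis .
    qed
    finally show ?thesis by (simp add: g_def)
  qed
  have "(LBINT t:{0<..<T}. (LBINT x. tent b h (h * t) x * partial_t \<phi> (t, x)
        + (tent b h (h * t) x)\<^sup>2 / 2 * partial_x \<phi> (t, x)))
      = (LBINT t:{0<..<T}. J (-b) t - J b t)"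
    by (intro set_lebesgue_integral_cong allI impI inner) auto
  \<comment> \<open>Adding the two end times, a null set, gives the closed interval that the
    fundamental theorem uses.\<close>
  also have "\<dots> = integral\<^sup>L lborel (\<lambda>t. indicator {0..T} t *\<^sub>R (J (-b) t - J b t))"
    unfolding set_lebesgue_integral_def
  proof (rule integral_cong_AE)
    note [measurable] = cJ[THEN borel_measurable_continuous_onI]
    show "(\<lambda>t. indicator {0<..<T} t *\<^sub>R (J (-b) t - J b t)) \<in> borel_measurable lborel"
      "(\<lambda>t. indicator {0..T} t *\<^sub>R (J (-b) t - J b t)) \<in> borel_measurable lborel"
      by measurable
    show "AE t in lborel. indicator {0<..<T} t *\<^sub>R (J (-b) t - J b t)
        = indicator {0..T} t *\<^sub>R (J (-b) t - J b t)"
      using AE_lborel_singleton[of 0] AE_lborel_singleton[of T]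
      by eventually_elim (auto simp: indicator_def)
  qed
  also have "\<dots> = (G (-b) T - G b T) - (G (-b) 0 - G b 0)"
  proof (rule integral_FTC_atLeastAtMost[OF T])
    fix t
    have "((\<lambda>t. G (-b) t - G b t) has_real_derivative J (-b) t - J b t) (at t)"
      using DERIV_diff[OF dG[of "-b" t] dG[of b t]] by simp
    then show "((\<lambda>t. G (-b) t - G b t) has_vector_derivative J (-b) t - J b t) (at t within {0..T})"
      by (simp add: has_real_derivative_iff_has_vector_derivative has_vector_derivative_at_within)
  qed (auto intro!: continuous_intros continuous_on_subset[OF cJ])
  also have "\<dots> = 0" by (simp add: G_def zero)
  finally show "(LBINT t:{0<..<T}. (LBINT x. tent b h (h * t) x * partial_t \<phi> (t, x)
        + (tent b h (h * t) x)\<^sup>2 / 2 * partial_x \<phi> (t, x))) = 0" .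
qed

section \<open>Continuity in time\<close>

lemma fourier_decay_mono: "fourier_decay B K f \<Longrightarrow> K \<le> K' \<Longrightarrow> fourier_decay B K' f"
  unfolding fourier_decay_def by (meson divide_right_mono order_trans add_nonneg_nonneg zero_le_one zero_le_power2)

text \<open>Up to time \<open>T\<close> the peak stays away from \<open>b\<close>, so the decay
  constant is uniform, and for nonzero \<xi> the explicit transform is continuous in time. Limits
  are tested along sequences, for which dominated convergence is available.\<close>

lemma continuous_into_sobolev_tent:
  assumes s: "s < 3 / 2" and h: "0 < h" and b: "h * T < b" "0 < b"
  shows "continuous_into_sobolev s {0..T} (\<lambda>t. tent b h (h * t))"
proof -
  \<comment> \<open>Each slope is bounded by its largest value on the time interval: the left one at
    time 0, the right one at time \<open>T\<close>.\<close>
  define K where "K = 2 * b * h + 2 * (h / b + h / (b - h * T))"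
  note h' = less_imp_le[OF h]
  have p: "\<bar>h * t\<bar> < b" if "t \<in> {0..T}" for t
  proof -
    have "0 \<le> h * t" "h * t \<le> h * T" using that h by auto
    then show ?thesis using b by auto
  qed
  have decay: "fourier_decay b K (tent b h (h * t))" if t: "t \<in> {0..T}" for t
  proof (rule fourier_decay_mono[OF fourier_decay_tent[OF p[OF t] h']])
    have "0 \<le> h * t" "h * t \<le> h * T" "h * t < b" using t h p[OF t] by auto
    then show "2 * b * h + 2 * (h / (b + h * t) + h / (b - h * t)) \<le> K"
      unfolding K_def using h b by (intro add_left_mono mult_left_mono add_mono divide_left_mono mult_pos_pos) auto
  qed
  show ?thesis
    unfolding continuous_into_sobolev_def tendsto_at_iff_sequentially
  proof (intro conjI ballI allI impI)
    show "tent b h (h * t) \<in> sobolev_space s" if "t \<in> {0..T}" for t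
      by (rule fourier_decay_in_sobolev_space[OF decay[OF that] s])
    fix t and X :: "nat \<Rightarrow> real"
    assume t: "t \<in> {0..T}" and X: "\<forall>i. X i \<in> {0..T} - {t}" and lim: "X \<longlonglongrightarrow> t"
    have X': "X n \<in> {0..T}" for n using X by blast
    have "(\<lambda>n. sobolev_norm s (\<lambda>x. tent b h (h * X n) x - tent b h (h * t) x)) \<longlonglongrightarrow> 0"
    proof (rule sobolev_norm_dominated_convergence[OF fourier_decay_diff(2)[OF decay[OF X'] decay[OF t]] s])
      show "AE \<xi> in lborel. (\<lambda>n. fourier_integral (\<lambda>x. tent b h (h * X n) x - tent b h (h * t) x) \<xi>)
          \<longlonglongrightarrow> 0"
        using AE_lborel_singleton[of 0]
      proof eventually_elim
        fix \<xi> :: real assume "\<xi> \<noteq> 0"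
        have "(\<lambda>n. fourier_integral (tent b h (h * X n)) \<xi>) \<longlonglongrightarrow> fourier_integral (tent b h (h * t)) \<xi>"
          unfolding fourier_integral_tent[OF p[OF t] h' \<open>\<xi> \<noteq> 0\<close>] fourier_integral_tent[OF p[OF X'] h' \<open>\<xi> \<noteq> 0\<close>]
          using p[OF t] \<open>\<xi> \<noteq> 0\<close> by (intro tendsto_intros lim) auto
        then show "(\<lambda>n. fourier_integral (\<lambda>x. tent b h (h * X n) x - tent b h (h * t) x) \<xi>) \<longlonglongrightarrow> 0"
          unfolding fourier_decay_diff(1)[OF decay[OF X'] decay[OF t]] by (simp add: LIM_zero)
      qed
    qed
    then show "((\<lambda>\<tau>. sobolev_norm s (\<lambda>x. tent b h (h * \<tau>) x - tent b h (h * t) x)) \<circ> X) \<longlonglongrightarrow> 0"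
      by (simp add: o_def)
  qed
qed

section \<open>Growth of the norm near the breaking time\<close>

text \<open>
  For \<open>2 \<le> (b - p) \<xi> \<le> 3\<close> the two points bounding the steep side are out of phase, so their
  contribution to the Fourier integral dominates.
\<close>

lemma norm_fourier_integral_steep_tent_ge:
  assumes p: "0 \<le> p" "p < b" and steep: "b - p \<le> b / 4" and h: "0 < h"
    and \<xi>: "2 / (b - p) \<le> \<xi>" "\<xi> \<le> 3 / (b - p)"
  shows "h / (2 * (b - p)) / \<xi>\<^sup>2 \<le> norm (fourier_integral (tent b h p) \<xi>)"
proof -
  define e where "e = (\<lambda>x. exp (- (\<i> * complex_of_real (x * \<xi>))))"
  define \<alpha> \<beta> where "\<alpha> = h / (b + p)" and "\<beta> = h / (b - p)"
  have bp: "0 < b - p" using p by simp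
  have "0 < \<xi>" using \<xi> bp by (auto intro: less_le_trans[OF _ \<xi>(1)])
  have unit: "norm (e x) = 1" for x by (simp add: e_def)
  have \<alpha>: "0 \<le> \<alpha>" using p h by (simp add: \<alpha>_def)
  have \<beta>: "0 \<le> \<beta>" using p h by (simp add: \<beta>_def)
  \<comment> \<open>Steepness gives \<open>4 * (b - p) \<le> b \<le> b + p\<close>.\<close>
  have "4 * \<alpha> \<le> \<beta>"
  proof -
    have "\<alpha> \<le> h / (4 * (b - p))"
      unfolding \<alpha>_def using p steep h by (intro divide_left_mono) auto
    also have "\<dots> = \<beta> / 4" by (simp only: \<beta>_def divide_divide_eq_left mult.commute)
    finally show ?thesis by simp
  qed
  have "1 \<le> norm (e p - e b)"
  proof -
    \<comment> \<open>The phase difference between \<open>p\<close> and \<open>b\<close>. As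
      \<open>[2, 3]\<close> lies in \<open>[pi / 2, pi]\<close>, its cosine is nonpositive, so the
      two exponentials are at distance at least 1.\<close>
    define \<theta> where "\<theta> = (b - p) * \<xi>"
    have "2 \<le> \<theta>" "\<theta> \<le> 3" using \<xi> bp by (simp_all add: \<theta>_def divide_simps mult.commute)
    then have "cos \<theta> \<le> 0"
      using pi_gt3 pi_less_4 cos_monotone_0_pi_le[of "pi / 2" \<theta>] by simp
    then have "1 \<le> Re (1 - exp (- (\<i> * complex_of_real \<theta>)))"
      by (simp add: Re_exp)
    also have "\<dots> \<le> norm (1 - exp (- (\<i> * complex_of_real \<theta>)))"
      by (rule complex_Re_le_cmod)
    also have "\<dots> = norm (e p * (1 - exp (- (\<i> * complex_of_real \<theta>))))"
      by (simp add: norm_mult unit)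
    also have "e p * (1 - exp (- (\<i> * complex_of_real \<theta>))) = e p - e b"
      by (simp add: e_def \<theta>_def algebra_simps flip: exp_add)
    finally show ?thesis .
  qed
  then have "\<beta> \<le> norm (of_real \<beta> * (e p - e b))"
    using \<beta> by (simp add: norm_mult mult_le_cancel_left1)
  moreover have "norm (of_real \<alpha> * (e p - e (-b))) \<le> 2 * \<alpha>"
    using \<alpha> norm_triangle_ineq4[of "e p" "e (-b)"]
    by (simp add: norm_mult unit mult_left_mono mult.commute[of 2])
  moreover have "norm (of_real \<beta> * (e p - e b)) - norm (of_real \<alpha> * (e p - e (-b)))
      \<le> norm (of_real \<beta> * (e p - e b) + of_real \<alpha> * (e p - e (-b)))"
    by (rule norm_diff_ineq)
  \<comment> \<open>The steep side contributes at least \<beta> and the other side at most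
    \<open>2 * \<alpha> \<le> \<beta> / 2\<close>.\<close>
  ultimately have "\<beta> / 2 \<le> norm (of_real \<beta> * (e p - e b) + of_real \<alpha> * (e p - e (-b)))"
    using \<open>4 * \<alpha> \<le> \<beta>\<close> by linarith
  also have "of_real \<beta> * (e p - e b) + of_real \<alpha> * (e p - e (-b))
      = of_real (\<alpha> + \<beta>) * e p - of_real \<alpha> * e (-b) - of_real \<beta> * e b"
    by (simp add: algebra_simps)
  finally have "\<beta> / 2 / \<xi>\<^sup>2
      \<le> norm (of_real (\<alpha> + \<beta>) * e p - of_real \<alpha> * e (-b) - of_real \<beta> * e b) / \<xi>\<^sup>2"
    by (rule divide_right_mono) simp
  also have "\<dots> = norm (fourier_integral (tent b h p) \<xi>)"
    unfolding e_def \<alpha>_def \<beta>_def using p h \<open>0 < \<xi>\<close>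
    by (subst fourier_integral_tent) (auto simp only: norm_divide norm_power norm_of_real power2_abs)
  finally show ?thesis by (simp add: \<beta>_def mult.commute)
qed

text \<open>Restrict the integral to the frequencies between \<open>2 / \<epsilon>\<close> and
  \<open>3 / \<epsilon>\<close>, a window of length \<open>1 / \<epsilon>\<close>. As
  \<open>s\<close> is at least 1, the weight is at least \<open>\<xi>\<^sup>2\<close>, so the
  integrand there is at least \<open>h\<^sup>2 / (4 * (\<epsilon> * \<xi>)\<^sup>2)\<close>, and
  \<open>\<epsilon> * \<xi> \<le> 3\<close> turns this into \<open>h\<^sup>2 / 36\<close>.\<close>

lemma sobolev_norm_steep_tent_ge:
  assumes s: "1 \<le> s" "s < 3 / 2" and p: "0 \<le> p" "p < b" and steep: "b - p \<le> b / 4" and h: "0 < h"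
  shows "sqrt (h\<^sup>2 / (36 * (b - p))) \<le> sobolev_norm s (tent b h p)"
proof -
  define \<epsilon> where "\<epsilon> = b - p"
  have \<epsilon>: "0 < \<epsilon>" using p by (simp add: \<epsilon>_def)
  have decay: "fourier_decay b (2 * b * h + 2 * (h / (b + p) + h / (b - p))) (tent b h p)"
    using p h by (intro fourier_decay_tent) auto
  have ge: "h\<^sup>2 / 36 \<le> (1 + \<xi>\<^sup>2) powr s * (norm (fourier_integral (tent b h p) \<xi>))\<^sup>2"
    if \<xi>: "\<xi> \<in> {2 / \<epsilon>..3 / \<epsilon>}" for \<xi>
  proof -
    have "0 < 2 / \<epsilon>" using \<epsilon> by simp
    also have "\<dots> \<le> \<xi>" using \<xi> by simp
    finally have "0 < \<xi>" .
    have "\<epsilon> * \<xi> \<le> 3" using \<xi> \<epsilon> by (auto simp: divide_simps mult.commute)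
    then have "(\<epsilon> * \<xi>)\<^sup>2 \<le> 3\<^sup>2" using \<epsilon> \<open>0 < \<xi>\<close> by (intro power_mono) auto
    then have "h\<^sup>2 / 36 \<le> h\<^sup>2 / (4 * (\<epsilon> * \<xi>)\<^sup>2)"
      using \<epsilon> \<open>0 < \<xi>\<close> by (intro divide_left_mono) auto
    also have "\<dots> = \<xi>\<^sup>2 * (h / (2 * \<epsilon>) / \<xi>\<^sup>2)\<^sup>2"
      using \<epsilon> \<open>0 < \<xi>\<close> by (simp add: field_simps power2_eq_square)
    also have "\<dots> \<le> (1 + \<xi>\<^sup>2) powr s * (norm (fourier_integral (tent b h p) \<xi>))\<^sup>2"
    proof (intro mult_mono power_mono)
      have "\<xi>\<^sup>2 \<le> (1 + \<xi>\<^sup>2) powr 1" by simp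
      also have "\<dots> \<le> (1 + \<xi>\<^sup>2) powr s" using s by (intro powr_mono) auto
      finally show "\<xi>\<^sup>2 \<le> (1 + \<xi>\<^sup>2) powr s" .
      show "h / (2 * \<epsilon>) / \<xi>\<^sup>2 \<le> norm (fourier_integral (tent b h p) \<xi>)"
        unfolding \<epsilon>_def using \<xi> p steep h
        by (intro norm_fourier_integral_steep_tent_ge) (auto simp: \<epsilon>_def)
    qed (use \<epsilon> h in auto)
    finally show ?thesis .
  qed
  have "h\<^sup>2 / (36 * \<epsilon>) = (LBINT \<xi>. indicator {2 / \<epsilon>..3 / \<epsilon>} \<xi> *\<^sub>R (h\<^sup>2 / 36))"
    using \<epsilon> by (simp add: divide_right_mono field_simps)
  also have "\<dots> \<le> (LBINT \<xi>. (1 + \<xi>\<^sup>2) powr s * (norm (fourier_integral (tent b h p) \<xi>))\<^sup>2)"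
    using ge by (intro integral_mono integrable_sobolev_fourier_integral[OF decay s(2)]
        borel_integrable_compact) (auto simp: indicator_def)
  finally show ?thesis
    by (simp add: sobolev_norm_fourier_integral[OF decay] \<epsilon>_def)
qed

section \<open>Initial data of small norm with prescribed slope\<close>

text \<open>Shrinking the base at fixed slope \<open>m\<close> keeps the decay constant bounded,
  while the L1 bound sends the transforms to 0 pointwise; dominated convergence then
  applies.\<close>

lemma sobolev_norm_small_tent:
  assumes s: "s < 3 / 2" and m: "0 < m" and \<delta>: "0 < \<delta>"
  obtains b where "0 < b" and "sobolev_norm s (tent b (m * b) 0) \<le> \<delta>"
proof -
  define b where "b = (\<lambda>n::nat. inverse (real (Suc n)))"
  have b: "0 < b n" "b n \<le> 1" for n by (auto simp: b_def divide_simps)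
  have lim: "b \<longlonglongrightarrow> 0"
    unfolding b_def by (rule LIMSEQ_inverse_real_of_nat)
  have "(\<lambda>n. sobolev_norm s (tent (b n) (m * b n) 0)) \<longlonglongrightarrow> 0"
  proof (rule sobolev_norm_dominated_convergence[OF _ s])
    fix n
    have "fourier_decay (b n) (2 * b n * (m * b n) + 2 * (m * b n / (b n + 0) + m * b n / (b n - 0)))
        (tent (b n) (m * b n) 0)"
      using b m by (intro fourier_decay_tent) (auto simp: less_imp_le)
    moreover have "b n * b n \<le> 1" using b[of n] by (intro mult_le_one) auto
    \<comment> \<open>The L1 part is at most \<open>2 * m\<close> since \<open>b n \<le> 1\<close>,
      and the two slopes, both \<open>m\<close>, contribute \<open>4 * m\<close>.\<close>
    then have "2 * b n * (m * b n) + 2 * (m * b n / (b n + 0) + m * b n / (b n - 0)) \<le> 6 * m"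
      using b[of n] m by (simp add: mult.left_commute mult_left_le)
    ultimately show "fourier_decay (b n) (6 * m) (tent (b n) (m * b n) 0)"
      by (rule fourier_decay_mono)
  next
    show "AE \<xi> in lborel. (\<lambda>n. fourier_integral (tent (b n) (m * b n) 0) \<xi>) \<longlonglongrightarrow> 0"
    proof (rule AE_I2)
      fix \<xi>
      show "(\<lambda>n. fourier_integral (tent (b n) (m * b n) 0) \<xi>) \<longlonglongrightarrow> 0"
      proof (rule Lim_null_comparison)
        show "\<forall>\<^sub>F n in sequentially.
            norm (fourier_integral (tent (b n) (m * b n) 0) \<xi>) \<le> 2 * b n * (m * b n)"
          using b m by (intro always_eventually allI norm_fourier_integral_tent_le) (auto simp: less_imp_le)
        show "(\<lambda>n. 2 * b n * (m * b n)) \<longlonglongrightarrow> 0"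
          using lim by (auto intro!: tendsto_eq_intros)
      qed
    qed
  qed
  then have "\<forall>\<^sub>F n in sequentially. sobolev_norm s (tent (b n) (m * b n) 0) < \<delta>"
    using \<delta> by (rule order_tendstoD)
  then obtain n where "sobolev_norm s (tent (b n) (m * b n) 0) < \<delta>"
    by (auto simp: eventually_sequentially)
  then show thesis using that b by (meson less_imp_le)
qed

section \<open>Choice of base, height and final time\<close>

theorem theorem1p1:
  fixes s \<delta> :: real
  assumes "1 \<le> s" and "s < 3 / 2" and "\<delta> > 0"
  shows "\<exists>u0 T0 u.
           u0 \<in> sobolev_space s \<and> sobolev_norm s u0 \<le> \<delta> \<and>
           0 < T0 \<and> T0 < \<delta> \<and>
           burgers_solution s T0 u0 u \<and>
           sobolev_norm s (u T0) \<ge> 1 / \<delta>"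
proof -
  obtain b where b: "0 < b" and small: "sobolev_norm s (tent b (2 / \<delta> * b) 0) \<le> \<delta>"
    using sobolev_norm_small_tent[of s "2 / \<delta>" \<delta>] assms by auto
  define h where "h = 2 / \<delta> * b"
  have h: "0 < h" using b assms by (simp add: h_def)
  \<comment> \<open>The final distance from the peak to the right foot. The first bound makes the
    tent steep; the second makes \<open>h\<^sup>2 / (36 * \<epsilon>)\<close> at least
    \<open>1 / \<delta>\<^sup>2\<close>.\<close>
  define \<epsilon> where "\<epsilon> = min (b / 4) (h\<^sup>2 * \<delta>\<^sup>2 / 36)"
  have \<epsilon>: "0 < \<epsilon>" "\<epsilon> \<le> b / 4" "\<epsilon> \<le> h\<^sup>2 * \<delta>\<^sup>2 / 36"
    using b h assms by (auto simp: \<epsilon>_def)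
  \<comment> \<open>The time at which the peak reaches \<open>b - \<epsilon>\<close>, just before
    breaking at \<open>b / h = \<delta> / 2\<close>.\<close>
  define T where "T = (b - \<epsilon>) / h"
  have hT: "h * T = b - \<epsilon>" using h by (simp add: T_def)
  have T: "0 < T" using b \<epsilon> h by (simp add: T_def)
  have "T < b / h" unfolding T_def using \<epsilon> h by (intro divide_strict_right_mono) auto
  also have "b / h = \<delta> / 2" using b assms by (simp add: h_def)
  finally have T\<delta>: "T < \<delta>" using assms by simp
  have cont: "continuous_into_sobolev s {0..T} (\<lambda>t. tent b h (h * t))"
    using assms h hT \<epsilon> b by (intro continuous_into_sobolev_tent) auto
  then have "tent b h (h * 0) \<in> sobolev_space s"
    using T unfolding continuous_into_sobolev_def by (meson atLeastAtMost_iff less_imp_le order_refl)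
  moreover have "burgers_solution s T (tent b h 0) (\<lambda>t. tent b h (h * t))"
    using cont burgers_distributional_tent[of h T b] h T hT \<epsilon> by (simp add: burgers_solution_def)
  moreover have "1 / \<delta> \<le> sobolev_norm s (tent b h (h * T))"
  proof -
    have "(1 / \<delta>)\<^sup>2 \<le> h\<^sup>2 / (36 * \<epsilon>)"
      using \<epsilon> assms by (simp add: field_simps power2_eq_square)
    then have "1 / \<delta> \<le> sqrt (h\<^sup>2 / (36 * \<epsilon>))" by (rule real_le_rsqrt)
    also have "\<dots> = sqrt (h\<^sup>2 / (36 * (b - h * T)))" by (simp add: hT)
    also have "\<dots> \<le> sobolev_norm s (tent b h (h * T))"
      using assms \<epsilon> h hT b by (intro sobolev_norm_steep_tent_ge) auto
    finally show ?thesis .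
  qed
  moreover have "sobolev_norm s (tent b h 0) \<le> \<delta>" using small by (simp add: h_def)
  ultimately show ?thesis using T T\<delta> by auto
qed

end
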